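(* Let $G$ be a connected, locally finite (possibly infinite) $L_1$-graph on at least three vertices such that $|N(u)\cap N(v)|\ge 2$ for each pair of vertices $u,v$ with $d(u,v)=2$, and let $x$ and $y$ be two vertices of $G$ with $d(x,y)\ge 3$. Then for every $x$–$y$ path $P_n$ with $n$ vertices in $G$ that does not contain all vertices of $G$, there is an $x$–$y$ path $P_{n+\ell}$ with $n+\ell$ vertices, $1\le\ell\le 2$, such that $V(P_n)\subset V(P_{n+\ell})$.
   Context: All graphs are simple. $N(u)$ denotes the neighborhood of $u$, $d(u)=|N(u)|$, and $d(u,v)$ the distance. A graph is locally finite if every vertex has finite degree. A graph $G$ is an $L_1$-graph if $d(u)+d(v)\ge |N(u)\cup N(v)\cup N(w)|-1$ for every triple of vertices $u,v,w$ with $d(u,v)=2$ and $w\in N(u)\cap N(v)$. *)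

theory Defs
  imports Main "HOL-Library.Extended_Nat"
begin

definition simple_graph :: "'a set \<Rightarrow> 'a set set \<Rightarrow> bool" where
  "simple_graph V E \<longleftrightarrow> (\<forall>e\<in>E. e \<subseteq> V \<and> card e = 2)"

definition neighborhood :: "'a set set \<Rightarrow> 'a \<Rightarrow> 'a set" where
  "neighborhood E u = {v. {u, v} \<in> E}"

definition degree :: "'a set set \<Rightarrow> 'a \<Rightarrow> nat" where
  "degree E u = card (neighborhood E u)"

definition locally_finite :: "'a set \<Rightarrow> 'a set set \<Rightarrow> bool" where
  "locally_finite V E \<longleftrightarrow> (\<forall>u\<in>V. finite (neighborhood E u))"

text \<open>A path is given by the list of its vertices in order, so a path with \<open>n\<close> vertices is a
  list of length \<open>n\<close> and has \<open>n - 1\<close> edges.\<close>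

definition graph_path :: "'a set \<Rightarrow> 'a set set \<Rightarrow> 'a \<Rightarrow> 'a \<Rightarrow> 'a list \<Rightarrow> bool" where
  "graph_path V E x y p \<longleftrightarrow>
     p \<noteq> [] \<and> hd p = x \<and> last p = y \<and> distinct p \<and> set p \<subseteq> V \<and>
     successively (\<lambda>u v. {u, v} \<in> E) p"

definition connected_graph :: "'a set \<Rightarrow> 'a set set \<Rightarrow> bool" where
  "connected_graph V E \<longleftrightarrow> (\<forall>u\<in>V. \<forall>v\<in>V. \<exists>p. graph_path V E u v p)"

text \<open>The distance is \<open>\<infinity>\<close> (the infimum of the empty set) if no path joins the two vertices.\<close>

definition graph_dist :: "'a set \<Rightarrow> 'a set set \<Rightarrow> 'a \<Rightarrow> 'a \<Rightarrow> enat" where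
  "graph_dist V E u v = (INF p\<in>{p. graph_path V E u v p}. enat (length p - 1))"

text \<open>The cardinalities below are meaningful only for locally finite graphs, since \<open>card\<close> is
  \<open>0\<close> on infinite sets. The inequality is over the integers to avoid truncated subtraction.\<close>

definition L1_graph :: "'a set \<Rightarrow> 'a set set \<Rightarrow> bool" where
  "L1_graph V E \<longleftrightarrow>
     (\<forall>u\<in>V. \<forall>v\<in>V. \<forall>w\<in>V. graph_dist V E u v = 2 \<and> w \<in> neighborhood E u \<inter> neighborhood E v \<longrightarrow>
        int (degree E u) + int (degree E v)
          \<ge> int (card (neighborhood E u \<union> neighborhood E v \<union> neighborhood E w)) - 1)"

end

theory Submission
  imports Defs
begin

text \<open>Let \<open>v\<close> be a vertex off the path \<open>p\<close> with a neighbour on it, and suppose that no path with one or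
  two more vertices contains \<open>p\<close> and \<open>v\<close>. Since \<open>d(x, y) \<ge> 3\<close>, we may assume that \<open>y\<close> is not adjacent
  to \<open>v\<close>. The successors of the neighbours of \<open>v\<close> on \<open>p\<close> are independent, and a double count of the
  edges between the neighbours and the successors shows that the local Ore condition at these edges
  is an equality. It follows that the neighbours of \<open>v\<close> on \<open>p\<close> are exactly every other vertex from \<open>x\<close>
  up to some point, say \<open>k\<close> of them.

  Exchanging \<open>v\<close> with the vertex between two consecutive neighbours gives a pair of the same kind, so
  \<open>k\<close> may be taken maximal. Comparing the two pairs for the second vertex of \<open>p\<close> shows that the
  neighbours of \<open>v\<close> are adjacent to all of their successors. Let \<open>w\<close> be the last neighbour of \<open>v\<close>,
  \<open>c\<close> its successor and \<open>s\<close> the vertex after \<open>c\<close>; it exists because otherwise \<open>c = y\<close> is adjacent to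
  \<open>x\<close>. Then \<open>w\<close> and \<open>s\<close> are at distance 2, and a common neighbour \<open>z \<noteq> c\<close> lies off the path.
  Equality in the local Ore condition makes \<open>z\<close> adjacent to two of \<open>v\<close>, \<open>c\<close> and the second vertex
  of \<open>p\<close>, and any two of them allow an extension by two vertices.\<close>

text \<open>The edge relation is the function \<open>N\<close>. Subtracting \<open>card (N u \<union> N v)\<close> from both sides of the
  defining inequality of an \<open>L\<^sub>1\<close>-graph gives assumption \<open>L1\<close>.\<close>

locale local_ore_graph =
  fixes N :: "'a \<Rightarrow> 'a set"
  assumes sym: "u \<in> N v \<Longrightarrow> v \<in> N u"
    and irrefl: "u \<notin> N u"
    and fin: "finite (N u)"
    and L1: "\<lbrakk>u \<noteq> v; u \<notin> N v; w \<in> N u; w \<in> N v\<rbrakk> \<Longrightarrow>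
      card (N w - (N u \<union> N v)) \<le> card (N u \<inter> N v) + 1"
    and two_common: "\<lbrakk>u \<noteq> v; u \<notin> N v; w \<in> N u; w \<in> N v\<rbrakk> \<Longrightarrow> 2 \<le> card (N u \<inter> N v)"
begin

section \<open>Paths and rerouting\<close>

definition xypath :: "'a \<Rightarrow> 'a \<Rightarrow> 'a list \<Rightarrow> bool" where
  "xypath x y p \<longleftrightarrow>
     p \<noteq> [] \<and> hd p = x \<and> last p = y \<and> distinct p \<and> successively (\<lambda>u v. v \<in> N u) p"

text \<open>Apart from the ends, only \<open>length p\<close> and \<open>insert v (set p)\<close>
  matter, so exchanging \<open>v\<close> with a path vertex preserves the property.\<close>

definition extendable :: "'a \<Rightarrow> 'a \<Rightarrow> 'a list \<Rightarrow> 'a \<Rightarrow> bool" where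
  "extendable x y p v \<longleftrightarrow>
     (\<exists>q. xypath x y q \<and> length q \<in> {length p + 1, length p + 2} \<and> insert v (set p) \<subseteq> set q)"

lemma extendableI:
  assumes "xypath x y q" "length q = length p + 1 \<or> length q = length p + 2"
    "insert v (set p) \<subseteq> set q"
  shows "extendable x y p v"
  using assms unfolding extendable_def by auto

lemma xypath_rev: "xypath x y p \<Longrightarrow> xypath y x (rev p)"
  using sym by (auto simp: xypath_def hd_rev last_rev successively_rev elim: successively_mono)

lemma extendable_rev: "extendable y x (rev p) v \<Longrightarrow> extendable x y p v"
  unfolding extendable_def using xypath_rev
  by (metis length_rev set_rev)

lemma xypath_adj: "xypath x y p \<Longrightarrow> Suc i < length p \<Longrightarrow> p ! Suc i \<in> N (p ! i)"
  by (auto simp: xypath_def successively_conv_nth)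

lemma xypath_eq_iff:
  "\<lbrakk>xypath x y p; i < length p; j < length p\<rbrakk> \<Longrightarrow> p ! i = p ! j \<longleftrightarrow> i = j"
  by (auto simp: xypath_def nth_eq_iff_index_eq)

lemma xypath_first: "xypath x y p \<Longrightarrow> p ! 0 = x"
  by (auto simp: xypath_def hd_conv_nth)

lemma xypath_last: "xypath x y p \<Longrightarrow> p ! (length p - 1) = y"
  by (auto simp: xypath_def last_conv_nth)

lemma last_take_conv_nth: "\<lbrakk>0 < i; i \<le> length p\<rbrakk> \<Longrightarrow> last (take i p) = p ! (i - 1)"
  by (subst last_conv_nth) auto

lemma xypath_insert:
  assumes p: "xypath x y p" and i: "Suc i < length p"
    and I: "I \<noteq> []" "distinct I" "successively (\<lambda>u v. v \<in> N u) I" "set I \<inter> set p = {}"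
    and adj: "hd I \<in> N (p ! i)" "p ! Suc i \<in> N (last I)"
  obtains q where "xypath x y q" "set q = set p \<union> set I" "length q = length p + length I"
proof
  define A B where "A = take (Suc i) p" and "B = drop (Suc i) p"
  have pAB: "p = A @ B" by (simp add: A_def B_def)
  have ne: "A \<noteq> []" "B \<noteq> []" using i by (auto simp: A_def B_def)
  have "last A = p ! i" using i by (simp add: A_def take_Suc_conv_app_nth)
  moreover have "hd B = p ! Suc i" using i by (simp add: B_def hd_drop_conv_nth)
  ultimately show "xypath x y (A @ I @ B)"
    using p I adj ne unfolding xypath_def pAB by (auto simp: successively_append_iff)
  show "set (A @ I @ B) = set p \<union> set I" "length (A @ I @ B) = length p + length I"
    by (auto simp: pAB)
qed

lemma extendable_insert1:
  assumes "xypath x y p" "Suc i < length p" "v \<notin> set p" "p ! i \<in> N v" "p ! Suc i \<in> N v"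
  shows "extendable x y p v"
proof -
  obtain q where "xypath x y q" "set q = set p \<union> set [v]" "length q = length p + length [v]"
    by (rule xypath_insert[OF assms(1,2), of "[v]"]) (use assms sym in auto)
  then show ?thesis by (intro extendableI[of _ _ q]) auto
qed

lemma extendable_insert2:
  assumes "xypath x y p" "Suc i < length p" "v \<notin> set p" "z \<notin> set p" "z \<in> N v"
    and "p ! i \<in> N v" "p ! Suc i \<in> N z"
  shows "extendable x y p v"
proof -
  have "z \<noteq> v" using assms(5) irrefl by auto
  obtain q where "xypath x y q" "set q = set p \<union> set [v, z]" "length q = length p + length [v, z]"
    by (rule xypath_insert[OF assms(1,2), of "[v, z]"]) (use assms sym \<open>z \<noteq> v\<close> in auto)
  then show ?thesis by (intro extendableI[of _ _ q]) auto
qed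

text \<open>The new path leaves \<open>p ! i\<close> through \<open>v\<close> to
  \<open>p ! j\<close>, runs back to \<open>p ! Suc i\<close> and jumps to
  \<open>p ! Suc j\<close>.\<close>

lemma extendable_crossing:
  assumes p: "xypath x y p" and ij: "i < j" "Suc j < length p" and v: "v \<notin> set p"
    and adj: "p ! i \<in> N v" "p ! j \<in> N v" "p ! Suc i \<in> N (p ! Suc j)"
  shows "extendable x y p v"
proof -
  define A M C where "A = take (Suc i) p" and "M = drop (Suc i) (take (Suc j) p)"
    and "C = drop (Suc j) p"
  have "take (Suc j) p = A @ M"
    using ij append_take_drop_id[of "Suc i" "take (Suc j) p"]
    by (simp add: A_def M_def min_absorb1)
  then have pAMC: "p = A @ M @ C"
    by (metis C_def append.assoc append_take_drop_id)
  have ne: "A \<noteq> []" "M \<noteq> []" "C \<noteq> []" using ij by (auto simp: A_def M_def C_def)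
  have ends: "last A = p ! i" "hd M = p ! Suc i" "last M = p ! j" "hd C = p ! Suc j"
    using ij last_take_conv_nth[of "Suc j" p] last_take_conv_nth[of "Suc i" p]
    by (auto simp: A_def M_def C_def hd_drop_conv_nth last_drop)
  have "successively (\<lambda>u v. v \<in> N u) (rev M)"
    using p sym unfolding xypath_def pAMC
    by (auto simp: successively_append_iff successively_rev elim: successively_mono)
  then have "xypath x y (A @ v # rev M @ C)"
    using p v ne ends adj sym unfolding xypath_def
    by (subst (asm) (1 2 3 4 5 6 7) pAMC)
       (auto simp: successively_append_iff successively_Cons hd_rev last_rev pAMC)
  then show ?thesis
    by (rule extendableI) (auto simp: pAMC)
qed

text \<open>A chord bypasses \<open>p ! i\<close>, which returns together with \<open>v\<close>
  between \<open>p ! j\<close> and \<open>p ! Suc j\<close>.\<close>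

lemma extendable_reinsert:
  assumes p: "xypath x y p" and i: "0 < i" "Suc i < length p" and j: "Suc j < length p"
    and ij: "i \<noteq> j" "i \<noteq> Suc j" and v: "v \<notin> set p"
    and adj: "p ! i \<in> N v" "p ! j \<in> N v" "p ! Suc i \<in> N (p ! (i - 1))" "p ! Suc j \<in> N (p ! i)"
  shows "extendable x y p v"
proof -
  define A C where "A = take i p" and "C = drop (Suc i) p"
  have pAC: "p = A @ p ! i # C" using i by (simp add: A_def C_def id_take_nth_drop)
  have ne: "A \<noteq> []" "C \<noteq> []" using i by (auto simp: A_def C_def)
  have ends: "last A = p ! (i - 1)" "hd C = p ! Suc i"
    using i last_take_conv_nth[of i p] by (auto simp: A_def C_def hd_drop_conv_nth)
  obtain w where w: "w = p ! i" by simp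
  have p': "p = A @ w # C" using pAC w by simp
  have AC: "xypath x y (A @ C)"
    using p ne ends adj(3) unfolding xypath_def
    by (subst (asm) (1 2 3 4 5) p') (auto simp: successively_append_iff successively_Cons)
  have w_fresh: "w \<notin> set (A @ C)"
    using p unfolding xypath_def by (subst (asm) (1 2 3 4 5) p') auto
  define j' where "j' = (if j < i then j else j - 1)"
  have nths: "Suc j' < length (A @ C)" "(A @ C) ! j' = p ! j" "(A @ C) ! Suc j' = p ! Suc j"
    using i j ij by (auto simp: j'_def A_def C_def nth_append)
  have vw: "v \<noteq> w" using v i w by auto
  have vAC: "v \<notin> set (A @ C)" using v p' by (metis Un_iff list.set_intros(2) set_append)
  obtain q where q: "xypath x y q" "set q = set (A @ C) \<union> set [v, w]"
      "length q = length (A @ C) + length [v, w]"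
    by (rule xypath_insert[OF AC nths(1), of "[v, w]"])
       (use w_fresh vAC vw adj w nths sym in auto)
  have "length p = Suc (length (A @ C))" "set p = insert w (set (A @ C))"
    by (subst p'; simp)+
  with q show ?thesis by (intro extendableI[of _ _ q]) auto
qed

lemma xypath_swap:
  assumes p: "xypath x y p" and i: "0 < i" "Suc i < length p" and v: "v \<notin> set p"
    and adj: "p ! (i - 1) \<in> N v" "p ! Suc i \<in> N v"
  shows "xypath x y (p[i := v])" "p ! i \<notin> set (p[i := v])"
    "insert (p ! i) (set (p[i := v])) = insert v (set p)"
proof -
  define A C where "A = take i p" and "C = drop (Suc i) p"
  obtain w where w: "w = p ! i" by simp
  have p': "p = A @ w # C" using i w by (simp add: A_def C_def id_take_nth_drop)
  have upd: "p[i := v] = A @ v # C" using i by (simp add: A_def C_def upd_conv_take_nth_drop)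
  have ne: "A \<noteq> []" "C \<noteq> []" using i by (auto simp: A_def C_def)
  have ends: "last A = p ! (i - 1)" "hd C = p ! Suc i"
    using i last_take_conv_nth[of i p] by (auto simp: A_def C_def hd_drop_conv_nth)
  have v': "v \<notin> set A" "v \<notin> set C" using v by (subst (asm) p'; simp)+
  show "xypath x y (p[i := v])"
    using p ne ends adj v' sym unfolding xypath_def upd
    by (subst (asm) (1 2 3 4 5) p') (auto simp: successively_append_iff successively_Cons)
  have "w \<notin> set A" "w \<notin> set C" using p unfolding xypath_def
    by (subst (asm) (1 2 3 4 5) p'; simp)+
  then show "p ! i \<notin> set (p[i := v])" using w v i unfolding upd by auto
  have "set p = insert w (set A \<union> set C)" by (subst p') auto
  then show "insert (p ! i) (set (p[i := v])) = insert v (set p)" using w unfolding upd by auto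
qed

end

section \<open>Consequences of having no extension\<close>

locale stuck_path = local_ore_graph N for N :: "'a \<Rightarrow> 'a set" +
  fixes x y :: 'a and p :: "'a list" and v :: 'a
  assumes path: "xypath x y p" and off: "v \<notin> set p" and touch: "\<exists>u\<in>set p. u \<in> N v"
    and last_off: "y \<notin> N v" and stuck: "\<not> extendable x y p v"
begin

definition W :: "nat set" where "W = {i. i < length p \<and> p ! i \<in> N v}"

text \<open>\<open>anchors j\<close> and \<open>tips i\<close> are neighbourhoods in the bipartite graph between the neighbours of \<open>v\<close> on
  the path and their successors; a successor is represented by the index of its predecessor.\<close>

definition anchors :: "nat \<Rightarrow> nat set" where "anchors j = {i \<in> W. p ! i \<in> N (p ! Suc j)}"

definition tips :: "nat \<Rightarrow> nat set" where "tips i = {j \<in> W. p ! i \<in> N (p ! Suc j)}"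

lemma finite_W: "finite W" "finite (anchors j)" "finite (tips i)"
  by (auto simp: W_def anchors_def tips_def)

lemma W_less: "i \<in> W \<Longrightarrow> Suc i < length p"
proof -
  assume i: "i \<in> W"
  then have "i \<noteq> length p - 1" using xypath_last[OF path] last_off by (auto simp: W_def)
  with i show ?thesis by (auto simp: W_def)
qed

lemma W_nonempty: "W \<noteq> {}"
  using touch by (auto simp: W_def in_set_conv_nth)

lemma nth_eq_iff: "i < length p \<Longrightarrow> j < length p \<Longrightarrow> p ! i = p ! j \<longleftrightarrow> i = j"
  using xypath_eq_iff[OF path] .

lemma nth_neq: "i < length p \<Longrightarrow> p ! i \<noteq> v"
  using off nth_mem by metis

lemma W_adj: "i \<in> W \<Longrightarrow> p ! i \<in> N v"
  by (simp add: W_def)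

lemma Suc_notin_W: "i \<in> W \<Longrightarrow> Suc i \<notin> W"
  using extendable_insert1[OF path W_less off] stuck by (auto simp: W_def)

lemma Suc_nonadj: "i \<in> W \<Longrightarrow> p ! Suc i \<notin> N v"
  using Suc_notin_W W_less by (auto simp: W_def)

lemma adj_Suc: "Suc i < length p \<Longrightarrow> p ! i \<in> N (p ! Suc i)"
  using xypath_adj[OF path] sym by auto

lemma common_on_path: "\<lbrakk>i \<in> W; z \<in> N v; z \<in> N (p ! Suc i)\<rbrakk> \<Longrightarrow> z \<in> set p"
  using extendable_insert2[OF path W_less off] stuck W_adj sym by metis

lemma Suc_indep:
  assumes "i \<in> W" "j \<in> W" shows "p ! Suc i \<notin> N (p ! Suc j)"
proof (cases i j rule: linorder_cases)
  case less
  then show ?thesis using extendable_crossing[OF path less W_less off] assms stuck W_adj by blast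
next
  case equal
  then show ?thesis using irrefl by simp
next
  case greater
  then show ?thesis
    using extendable_crossing[OF path greater W_less off] assms stuck W_adj sym by blast
qed

text \<open>A common neighbour off the path could be inserted with \<open>v\<close> between
  \<open>p ! j\<close> and \<open>p ! Suc j\<close>.\<close>

lemma card_common:
  assumes "j \<in> W" shows "card (N v \<inter> N (p ! Suc j)) = card (anchors j)"
proof -
  have "N v \<inter> N (p ! Suc j) = (!) p ` anchors j"
    using common_on_path[OF assms] by (force simp: anchors_def W_def in_set_conv_nth)
  moreover have "inj_on ((!) p) (anchors j)"
    using nth_eq_iff by (auto simp: inj_on_def anchors_def W_def)
  ultimately show ?thesis by (simp add: card_image)
qed

section \<open>Sharpness of the local Ore condition\<close>

lemma anchors_self: "j \<in> W \<Longrightarrow> j \<in> anchors j"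
  using adj_Suc W_less by (auto simp: anchors_def)

lemma two_le_anchors:
  assumes "j \<in> W" shows "2 \<le> card (anchors j)"
proof -
  have "p ! Suc j \<noteq> v" "v \<notin> N (p ! Suc j)"
    using assms W_less nth_neq Suc_nonadj sym by blast+
  then have "2 \<le> card (N v \<inter> N (p ! Suc j))"
    by (intro two_common[of _ _ "p ! j"]) (use assms adj_Suc W_less W_adj in auto)
  then show ?thesis by (simp add: card_common[OF assms])
qed

text \<open>The local Ore condition for \<open>v\<close>, \<open>p ! Suc j\<close> and
  \<open>p ! i\<close> bounds the right-hand set, hence \<open>card (tips i) + 1\<close>.\<close>

lemma private_subset:
  assumes "i \<in> anchors j" "j \<in> W"
  shows "insert v ((\<lambda>l. p ! Suc l) ` tips i) \<subseteq> N (p ! i) - (N v \<union> N (p ! Suc j))"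
  using assms Suc_indep Suc_nonadj W_adj sym irrefl
  by (fastforce simp: anchors_def tips_def)

lemma card_private:
  "card (insert v ((\<lambda>l. p ! Suc l) ` tips i)) = card (tips i) + 1"
proof -
  have "inj_on (\<lambda>l. p ! Suc l) (tips i)"
    using nth_eq_iff W_less by (auto simp: inj_on_def tips_def)
  moreover have "v \<notin> (\<lambda>l. p ! Suc l) ` tips i"
    using nth_neq W_less by (auto simp: tips_def)
  ultimately show ?thesis using finite_W by (simp add: card_image)
qed

lemma L1_path:
  assumes "i \<in> anchors j" "j \<in> W"
  shows "card (N (p ! i) - (N v \<union> N (p ! Suc j))) \<le> card (anchors j) + 1"
proof -
  have "p ! Suc j \<noteq> v" "v \<notin> N (p ! Suc j)"
    using assms W_less nth_neq Suc_nonadj sym by blast+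
  then show ?thesis
    using L1[of v "p ! Suc j" "p ! i"] assms W_adj card_common by (auto simp: anchors_def)
qed

lemma tips_le_anchors:
  assumes "i \<in> anchors j" "j \<in> W" shows "card (tips i) \<le> card (anchors j)"
  using card_mono[OF _ private_subset[OF assms]] L1_path[OF assms] fin
  by (simp add: card_private)

lemma sum_anchors_tips:
  "(\<Sum>j\<in>W. \<Sum>i\<in>anchors j. h i j) = (\<Sum>i\<in>W. \<Sum>j\<in>tips i. h i j)" for h :: "nat \<Rightarrow> nat \<Rightarrow> nat"
  unfolding anchors_def tips_def using finite_W by (intro sum.swap_restrict)

text \<open>Summed over \<open>i \<in> W\<close>, both sides count the edges of the bipartite graph, so the inequality
  \<open>tips_le_anchors\<close> at the edges \<open>(i, i)\<close> is an equality.\<close>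

lemma tips_eq_anchors_self:
  assumes "i \<in> W" shows "card (tips i) = card (anchors i)"
proof (rule ccontr)
  assume "card (tips i) \<noteq> card (anchors i)"
  then have "(\<Sum>i\<in>W. card (tips i)) < (\<Sum>i\<in>W. card (anchors i))"
    using assms finite_W tips_le_anchors[OF anchors_self]
    by (intro sum_strict_mono_ex1) (auto simp: le_neq_implies_less intro!: bexI[of _ i])
  with sum_anchors_tips[of "\<lambda>i j. 1"] show False by simp
qed

text \<open>Summed over the edges of this bipartite graph, \<open>card (tips i)\<close> and \<open>card (anchors j)\<close> both give
  \<open>\<Sum>i\<in>W. (card (anchors i))\<^sup>2\<close>, so the inequality is sharp on each edge.\<close>

lemma tips_eq_anchors:
  assumes "i \<in> anchors j" "j \<in> W" shows "card (tips i) = card (anchors j)"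
proof (rule ccontr)
  assume ne: "card (tips i) \<noteq> card (anchors j)"
  have "(\<Sum>j\<in>W. \<Sum>i\<in>anchors j. card (tips i)) < (\<Sum>j\<in>W. \<Sum>i\<in>anchors j. card (anchors j))"
  proof (rule sum_strict_mono_ex1)
    have "(\<Sum>i\<in>anchors j. card (tips i)) < (\<Sum>i\<in>anchors j. card (anchors j))"
      using assms ne tips_le_anchors finite_W
      by (intro sum_strict_mono_ex1) (auto simp: le_neq_implies_less intro!: bexI[of _ i])
    then show "\<exists>j\<in>W. (\<Sum>i\<in>anchors j. card (tips i)) < (\<Sum>i\<in>anchors j. card (anchors j))"
      using assms(2) by blast
  qed (use finite_W tips_le_anchors in \<open>auto intro: sum_mono simp del: sum_constant\<close>)
  moreover have "(\<Sum>j\<in>W. \<Sum>i\<in>anchors j. card (tips i)) = (\<Sum>i\<in>W. \<Sum>j\<in>tips i. card (tips i))"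
    by (rule sum_anchors_tips)
  moreover have "\<dots> = (\<Sum>i\<in>W. \<Sum>j\<in>anchors i. card (anchors i))"
    by (simp add: tips_eq_anchors_self)
  ultimately show False by simp
qed

text \<open>Sharpness turns the inclusion \<open>private_subset\<close> into an equality.\<close>

lemma neighbour_cases:
  assumes "i \<in> anchors j" "j \<in> W" "z \<in> N (p ! i)"
  shows "z \<in> N v \<or> z \<in> N (p ! Suc j) \<or> z = v \<or> (\<exists>l\<in>W. z = p ! Suc l)"
proof -
  have "insert v ((\<lambda>l. p ! Suc l) ` tips i) = N (p ! i) - (N v \<union> N (p ! Suc j))"
    using L1_path[OF assms(1,2)] fin
    by (intro card_seteq private_subset assms) (simp_all add: card_private tips_eq_anchors[OF assms(1,2)])
  with assms(3) show ?thesis by (auto simp: tips_def)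
qed

section \<open>Positions of the neighbours of \<open>v\<close>\<close>

lemma W_down:
  assumes i: "i \<in> W" "0 < i" shows "2 \<le> i" "i - 2 \<in> W"
proof -
  let ?z = "p ! (i - 1)"
  have z: "?z \<in> N (p ! i)" using adj_Suc[of "i - 1"] i W_less[of i] xypath_adj[OF path, of "i - 1"] sym
    by (simp add: W_def)
  have znv: "?z \<notin> N v"
    using i Suc_notin_W[of "i - 1"] by (cases i) (auto simp: W_def)
  \<comment> \<open>A second successor \<open>p ! Suc j\<close> adjacent to \<open>p ! i\<close>
    gives a place where \<open>p ! i\<close> can be reinserted.\<close>
  have "\<not> tips i \<subseteq> {i}"
    using two_le_anchors[OF i(1)] tips_eq_anchors_self[OF i(1)] card_mono[of "{i}" "tips i"] by auto
  then obtain j where j: "j \<in> W" "p ! i \<in> N (p ! Suc j)" "j \<noteq> i"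
    by (auto simp: tips_def)
  have "?z \<notin> N (p ! Suc i)"
  proof
    assume "?z \<in> N (p ! Suc i)"
    then have "extendable x y p v"
      using i j W_less W_adj Suc_notin_W sym
      by (intro extendable_reinsert[OF path, of i j] off) blast+
    then show False using stuck by simp
  qed
  then obtain l where l: "l \<in> W" "?z = p ! Suc l"
    using neighbour_cases[OF anchors_self[OF i(1)] i(1) z] znv nth_neq[of "i - 1"] W_less[OF i(1)]
    by auto
  then have "i - 1 = Suc l"
    using nth_eq_iff[of "i - 1" "Suc l"] W_less[OF i(1)] W_less[OF l(1)] by simp
  then show "2 \<le> i" "i - 2 \<in> W" using l by (cases i; auto)+
qed

text \<open>Descending by \<open>W_down\<close> from any index ends at 0, which gives parity;
  descending from the maximum leaves no gaps.\<close>

lemma W_iff: "i \<in> W \<longleftrightarrow> even i \<and> i < 2 * card W"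
proof -
  define m where "m = Max W"
  have m: "m \<in> W" "\<And>i. i \<in> W \<Longrightarrow> i \<le> m"
    using W_nonempty finite_W by (auto simp: m_def)
  have ev: "even i" if "i \<in> W" for i
    using that
  proof (induction i rule: less_induct)
    case (less i)
    then show ?case using W_down[of i] less.IH[of "i - 2"] by (cases "i = 0") auto
  qed
  have down: "m - 2 * d \<in> W" if "2 * d \<le> m" for d
    using that
  proof (induction d)
    case (Suc d)
    then show ?case using W_down[of "m - 2 * d"] by (simp add: diff_diff_left)
  qed (simp add: m)
  have "i \<in> W" if "even i" "i \<le> m" for i
    using down[of "(m - i) div 2"] that ev[OF m(1)] by simp
  with ev m have "W = {i. even i \<and> i \<le> m}" by auto
  also have "\<dots> = (*) 2 ` {..m div 2}" using ev[OF m(1)] by (auto elim!: evenE)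
  finally have W: "W = (*) 2 ` {..m div 2}" .
  then have "card W = m div 2 + 1" by (simp add: card_image inj_on_def)
  then show ?thesis by (subst W) (auto elim!: evenE)
qed

text \<open>The path edge after \<open>p ! Suc (2 * j)\<close> puts \<open>2 * Suc j\<close> into
  \<open>anchors (2 * j)\<close>; sharpness there links consecutive counts.\<close>

lemma card_anchors_const: "2 * j \<in> W \<Longrightarrow> card (anchors (2 * j)) = card (anchors 0)"
proof (induction j)
  case (Suc j)
  then have W: "2 * j \<in> W" by (simp add: W_iff)
  have "2 * Suc j \<in> anchors (2 * j)"
    using Suc.prems W_less[OF Suc.prems] xypath_adj[OF path, of "Suc (2 * j)"] by (auto simp: anchors_def)
  then show ?case
    using tips_eq_anchors[OF _ W] tips_eq_anchors_self[OF Suc.prems] Suc.IH[OF W] by simp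
qed simp

lemma start_adj: "x \<in> N v"
  using W_adj[of 0] W_iff[of 0] W_nonempty finite_W xypath_first[OF path]
  by (simp add: card_gt_0_iff)

lemma two_le_card_W: "2 \<le> card W"
proof -
  obtain j where j: "j \<in> W" using W_nonempty by blast
  have "card (anchors j) \<le> card W" by (rule card_mono[OF finite_W(1)]) (auto simp: anchors_def)
  with two_le_anchors[OF j] show ?thesis by simp
qed

end

section \<open>Exchanging \<open>v\<close> with path vertices\<close>

context local_ore_graph
begin

text \<open>The measure falls as \<open>v\<close> gains neighbours on the path, so a counterexample
  may be taken with maximal neighbour count under exchanges.\<close>

lemma extendable_if_start_adj:
  assumes "xypath x y p" "v \<notin> set p" "x \<in> N v"
    and far: "N x \<inter> N y = {}" "y \<notin> N x"
  shows "extendable x y p v"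
  using assms(1-3)
proof (induction "length p - card {i. i < length p \<and> p ! i \<in> N v}" arbitrary: p v rule: less_induct)
  case less
  show ?case
  proof (rule ccontr)
    assume stuck: "\<not> extendable x y p v"
    interpret S: stuck_path N x y p v
      using less.prems stuck far sym
      by unfold_locales (auto simp: xypath_def intro!: bexI[of _ x])
    define k where "k = card S.W"
    have k: "2 \<le> k" "\<And>i. i \<in> S.W \<longleftrightarrow> even i \<and> i < 2 * k"
      using S.two_le_card_W S.W_iff by (auto simp: k_def)
    have kn: "2 * k \<le> length p"
      using S.W_less[of "2 * k - 2"] k by auto
    have swap: "stuck_path N x y (p[Suc (2 * j) := v]) (p ! Suc (2 * j)) \<and>
        card (stuck_path.W N (p[Suc (2 * j) := v]) (p ! Suc (2 * j))) \<le> k"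
      if j: "Suc j < k" and xb: "x \<in> N (p ! Suc (2 * j))" for j
    proof -
      let ?p = "p[Suc (2 * j) := v]" and ?b = "p ! Suc (2 * j)"
      have W: "2 * j \<in> S.W" "2 * Suc j \<in> S.W" using j k(2) by auto
      have sw: "xypath x y ?p" "?b \<notin> set ?p" "insert ?b (set ?p) = insert v (set p)"
        by (rule xypath_swap[OF S.path _ _ S.off];
            use W S.W_less[OF W(2)] S.W_adj in \<open>fastforce\<close>)+
      then have ne: "\<not> extendable x y ?p ?b"
        using stuck unfolding extendable_def by auto
      then interpret U: stuck_path N x y ?p ?b
        using sw xb far sym
        by unfold_locales (auto simp: xypath_def intro!: bexI[of _ x])
      have "card U.W \<le> k"
      proof (rule ccontr)
        assume "\<not> card U.W \<le> k"
        \<comment> \<open>This makes the truncated subtraction in the measure drop strictly.\<close>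
        moreover have "k < length p" using kn k(1) by linarith
        ultimately have "length ?p - card {i. i < length ?p \<and> ?p ! i \<in> N ?b}
            < length p - card {i. i < length p \<and> p ! i \<in> N v}"
          by (fold U.W_def S.W_def k_def) auto
        from less.hyps[OF this sw(1,2) xb] show False using ne by simp
      qed
      then show ?thesis using U.stuck_path_axioms by simp
    qed
    have W0: "0 \<in> S.W" using k by auto
    have x0: "p ! 0 = x" using xypath_first[OF S.path] .
    have xb0: "x \<in> N (p ! Suc 0)"
      using S.anchors_self[OF W0] x0 by (auto simp: S.anchors_def)
    interpret T: stuck_path N x y "p[Suc 0 := v]" "p ! Suc 0"
      using swap[of 0] k(1) xb0 by simp
    have Tle: "card T.W \<le> k" using swap[of 0] k(1) xb0 by simp
    have nth_upd: "p[Suc 0 := v] ! i = p ! i" if "i \<noteq> Suc 0" for i using that by simp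
    have nth_1: "p[Suc 0 := v] ! Suc 0 = v" using kn k(1) by simp
    \<comment> \<open>Both index sets are initial segments of the even numbers, so comparing sizes
      suffices.\<close>
    have T_sub: "T.W \<subseteq> S.W" using Tle T.W_iff k(2) by fastforce
    have S0: "S.anchors 0 = T.W"
    proof -
      have "i \<in> S.anchors 0 \<longleftrightarrow> i \<in> T.W" if "i \<in> S.W" for i
        using that k(2)[of i] nth_upd[of i] by (auto simp: S.anchors_def S.W_def T.W_def)
      then show ?thesis using T_sub by (auto simp: S.anchors_def)
    qed
    \<comment> \<open>The second vertex of the exchanged path is \<open>v\<close> itself.\<close>
    have T0: "T.anchors 0 = T.W"
      using T_sub T.W_iff nth_1 nth_upd by (fastforce simp: T.anchors_def S.W_def)
    have T_all: "T.anchors j = T.W" if "j \<in> T.W" for j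
    proof (rule card_subset_eq[OF T.finite_W(1)])
      show "T.anchors j \<subseteq> T.W" by (auto simp: T.anchors_def)
      show "card (T.anchors j) = card T.W"
        using T.card_anchors_const[of "j div 2"] that T.W_iff[of j] T0 by simp
    qed
    have S_card: "card (S.anchors j) = card T.W" if "j \<in> S.W" for j
      using S.card_anchors_const[of "j div 2"] that k(2)[of j] S0 by simp
    have "card T.W = k"
    proof (rule ccontr)
      assume "card T.W \<noteq> k"
      \<comment> \<open>The last index of \<open>T.W\<close>. If \<open>T.W\<close> were smaller
        than \<open>S.W\<close>, \<open>p ! Suc j\<close> would be adjacent to all vertices indexed
        by \<open>T.W\<close> and to its own path successor, exceeding
        \<open>S_card\<close>.\<close>
      define j where "j = 2 * card T.W - 2"
      have j: "j \<in> T.W" "2 \<le> j" "j \<in> S.W" "Suc (Suc j) \<in> S.W" "Suc (Suc j) \<notin> T.W"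
        using T.two_le_card_W Tle \<open>card T.W \<noteq> k\<close> by (auto simp: j_def k(2) T.W_iff)
      have "insert (Suc (Suc j)) T.W \<subseteq> S.anchors j"
      proof
        fix i assume "i \<in> insert (Suc (Suc j)) T.W"
        then show "i \<in> S.anchors j"
        proof
          assume "i = Suc (Suc j)"
          then show ?thesis
            using j xypath_adj[OF S.path, of "Suc j"] S.W_less[of "Suc (Suc j)"]
            by (auto simp: S.anchors_def)
        next
          assume i: "i \<in> T.W"
          then have "i \<in> T.anchors j" using T_all[OF j(1)] by simp
          moreover have "i \<noteq> Suc 0" using i T.W_iff[of i] by auto
          ultimately show ?thesis
            using j(2) T_sub i nth_upd[of i] nth_upd[of "Suc j"]
            by (auto simp: T.anchors_def S.anchors_def)
        qed
      qed
      from card_mono[OF S.finite_W(2) this] show False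
        using S_card[OF j(3)] j(5) T.finite_W(1) by simp
    qed
    then have TW: "T.W = S.W" using T.W_iff k(2) by auto
    have complete: "p ! i \<in> N (p ! Suc j)" if "i \<in> S.W" "j \<in> S.W" for i j
    proof -
      have "S.anchors j = S.W"
        by (rule card_subset_eq[OF S.finite_W(1)])
           (use S_card[OF that(2)] TW in \<open>auto simp: S.anchors_def\<close>)
      then show ?thesis using that by (auto simp: S.anchors_def)
    qed
    have last: "2 * k - 2 \<in> S.W" "Suc (2 * k - 2) = 2 * k - 1" using k by auto
    have "length p \<noteq> 2 * k"
      using complete[OF W0 last(1)] xypath_last[OF S.path] last(2) x0 far(2) sym by auto
    with kn have len: "2 * k < length p" by simp
    let ?s = "p ! (2 * k)" and ?w = "p ! (2 * k - 2)" and ?c = "p ! (2 * k - 1)"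
    have s_v: "?s \<notin> N v" using len k(2)[of "2 * k"] by (auto simp: S.W_def)
    \<comment> \<open>Otherwise, after exchanging \<open>v\<close> with \<open>p ! Suc l\<close>,
      the index \<open>2 * k\<close> would force more than \<open>k\<close> neighbours.\<close>
    have s_b: "?s \<notin> N (p ! Suc l)" if l: "l \<in> S.W" "l \<noteq> 2 * k - 2" for l
    proof
      assume s: "?s \<in> N (p ! Suc l)"
      obtain j where j: "l = 2 * j" "Suc j < k" using l k(2)[of l] by (auto elim!: evenE)
      interpret U: stuck_path N x y "p[Suc (2 * j) := v]" "p ! Suc (2 * j)"
        using swap[of j] j complete[OF W0 l(1)] x0 by simp
      have "2 * k \<in> U.W" using s len j by (auto simp: U.W_def)
      moreover have "card U.W \<le> k" using swap[of j] j complete[OF W0 l(1)] x0 by simp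
      ultimately show False using U.W_iff[of "2 * k"] by simp
    qed
    have b0: "0 \<in> S.W" "0 \<noteq> 2 * k - 2" using W0 k(1) by auto
    \<comment> \<open>By \<open>neighbour_cases\<close>, \<open>?s\<close> would be a successor and
      so have an odd index.\<close>
    have s_w: "?s \<notin> N (p ! i)" if i: "i \<in> S.W" for i
    proof
      assume s: "?s \<in> N (p ! i)"
      have "i \<in> S.anchors 0" using complete[OF i W0] i by (simp add: S.anchors_def)
      from S.neighbour_cases[OF this W0 s] obtain l where "l \<in> S.W" "?s = p ! Suc l"
        using s_v s_b[OF b0] S.nth_neq[OF len] by auto
      then have "2 * k = Suc l" "even l" using S.nth_eq_iff[OF len S.W_less] k(2) by auto
      then show False by presburger
    qed
    have wc: "?c \<in> N ?w" "?c \<in> N ?s"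
      using complete[OF last(1) last(1)] last(2) xypath_adj[OF S.path, of "2 * k - 1"] len k(1) sym
      by auto
    have "?w \<noteq> ?s" using S.nth_eq_iff len k(1) by auto
    from two_common[OF this _ wc] have "2 \<le> card (N ?w \<inter> N ?s)"
      using s_w[OF last(1)] sym by blast
    then have "\<not> N ?w \<inter> N ?s \<subseteq> {?c}" using card_mono[of "{?c}" "N ?w \<inter> N ?s"] by auto
    then obtain z where z: "z \<in> N ?w" "z \<in> N ?s" "z \<noteq> ?c" by blast
    have anch: "2 * k - 2 \<in> S.anchors 0" "2 * k - 2 \<in> S.anchors (2 * k - 2)"
      using complete W0 last(1) by (auto simp: S.anchors_def)
    \<comment> \<open>On the path, \<open>z\<close> is not indexed by \<open>S.W\<close> by
      \<open>s_w\<close>, nor adjacent to \<open>p ! Suc 0\<close> by \<open>TW\<close>. So it is a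
      successor, and being adjacent to \<open>?s\<close> it must be \<open>?c\<close> by
      \<open>s_b\<close>.\<close>
    have z_off: "z \<notin> set p"
    proof
      assume "z \<in> set p"
      then obtain m where m: "m < length p" "z = p ! m" by (auto simp: in_set_conv_nth)
      have mW: "m \<notin> S.W" using s_w[of m] z(2) m sym by auto
      have "z \<notin> N (p ! Suc 0)"
      proof
        assume "z \<in> N (p ! Suc 0)"
        then have "m \<noteq> Suc 0" using m irrefl by auto
        then have "m \<in> T.W" using \<open>z \<in> N (p ! Suc 0)\<close> m by (simp add: T.W_def)
        with TW mW show False by simp
      qed
      with S.neighbour_cases[OF anch(1) W0 z(1)] obtain l where l: "l \<in> S.W" "z = p ! Suc l"
        using mW m S.nth_neq by (auto simp: S.W_def)
      then show False using s_b[of l] z last(2) sym by (cases "l = 2 * k - 2") auto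
    qed
    have z_v: "z \<noteq> v" using z(2) s_v sym by blast
    have z_off': "z \<notin> set (p[Suc 0 := v])" using z_off z_v set_update_subset_insert[of p "Suc 0" v] by blast
    \<comment> \<open>Sharpness at \<open>?w\<close> is used for each two of \<open>v\<close>,
      \<open>p ! Suc 0\<close> and \<open>?c\<close>; the pair without \<open>v\<close> needs the
      exchanged path.\<close>
    have v_b0: "z \<in> N v \<or> z \<in> N (p ! Suc 0)"
      using S.neighbour_cases[OF anch(1) W0 z(1)] z_v z_off S.W_less nth_mem by auto
    have v_c: "z \<in> N v \<or> z \<in> N ?c"
      using S.neighbour_cases[OF anch(2) last(1) z(1)] z_v z_off S.W_less nth_mem last(2) by auto
    have b0_c: "z \<in> N (p ! Suc 0) \<or> z \<in> N ?c"
    proof -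
      have a: "2 * k - 2 \<in> T.anchors (2 * k - 2)" "2 * k - 2 \<in> T.W"
        using T_all last(1) TW by auto
      have "p[Suc 0 := v] ! (2 * k - 2) = ?w" "p[Suc 0 := v] ! Suc (2 * k - 2) = ?c" "p ! Suc 0 \<in> set p"
        using k(1) last(2) len by auto
      then show ?thesis
        using T.neighbour_cases[OF a, of z] z(1) z_off z_off' T.W_less nth_mem by metis
    qed
    have "\<not> (z \<in> N v \<and> z \<in> N ?c)"
      using S.common_on_path[OF last(1)] z_off last(2) by metis
    moreover have "\<not> (z \<in> N v \<and> z \<in> N (p ! Suc 0))"
      using T.common_on_path[of 0 z] TW W0 nth_1 z_off' by auto
    moreover have "\<not> (z \<in> N (p ! Suc 0) \<and> z \<in> N ?c)"
      using T.common_on_path[of "2 * k - 2" z] TW last nth_upd[of "2 * k - 1"] k(1) z_off' by auto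
    ultimately show False using v_b0 v_c b0_c by blast
  qed
qed

text \<open>If only \<open>y\<close> is adjacent to \<open>v\<close>, the path is reversed; if
  neither end is, \<open>start_adj\<close> excludes a stuck path.\<close>

lemma extendable_if_touching:
  assumes p: "xypath x y p" "v \<notin> set p" "u \<in> set p" "u \<in> N v"
    and far: "N x \<inter> N y = {}" "y \<notin> N x"
  shows "extendable x y p v"
proof (cases "x \<in> N v \<or> y \<in> N v")
  case True
  then show ?thesis
  proof
    assume "y \<in> N v"
    then have "extendable y x (rev p) v"
      using p far sym by (intro extendable_if_start_adj xypath_rev) auto
    then show ?thesis by (rule extendable_rev)
  qed (use p far extendable_if_start_adj in blast)
next
  case False
  show ?thesis
  proof (rule ccontr)
    assume "\<not> extendable x y p v"
    then interpret stuck_path N x y p v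
      using p False by unfold_locales auto
    show False using start_adj False by blast
  qed
qed

end

section \<open>Transfer to graphs given by vertex and edge sets\<close>

lemma exit_edge:
  assumes "successively R q" "q \<noteq> []" "hd q \<in> S" "last q \<notin> S"
  shows "\<exists>u\<in>S. \<exists>v. v \<notin> S \<and> R u v"
  using assms
proof (induction q)
  case (Cons a q)
  then show ?case by (cases "q = []"; cases "hd q \<in> S") (auto simp: successively_Cons)
qed simp

lemma graph_dist_le: "graph_path V E u v p \<Longrightarrow> graph_dist V E u v \<le> enat (length p - 1)"
  unfolding graph_dist_def by (rule INF_lower) simp

lemma mem_neighborhood_sym: "u \<in> neighborhood E v \<longleftrightarrow> v \<in> neighborhood E u"
  by (simp add: neighborhood_def insert_commute)

lemma not_mem_neighborhood_self: "simple_graph V E \<Longrightarrow> u \<notin> neighborhood E u"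
  by (fastforce simp: neighborhood_def simple_graph_def)

lemma neighborhood_in_V:
  "simple_graph V E \<Longrightarrow> v \<in> neighborhood E u \<Longrightarrow> u \<in> V \<and> v \<in> V"
  by (fastforce simp: neighborhood_def simple_graph_def)

lemma graph_dist_eq_2:
  assumes G: "simple_graph V E" and uv: "u \<noteq> v" "u \<notin> neighborhood E v"
    and w: "w \<in> neighborhood E u" "w \<in> neighborhood E v"
  shows "graph_dist V E u v = 2"
proof (rule antisym)
  have "graph_path V E u v [u, w, v]"
    using uv w neighborhood_in_V[OF G] not_mem_neighborhood_self[OF G]
    by (auto simp: graph_path_def neighborhood_def insert_commute)
  from graph_dist_le[OF this] show "graph_dist V E u v \<le> 2"
    by (simp add: numeral_eq_enat numeral_2_eq_2)
  have "2 \<le> length p - 1" if p: "graph_path V E u v p" for p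
  proof (rule ccontr)
    assume "\<not> 2 \<le> length p - 1"
    then consider "p = []" | a where "p = [a]" | a b where "p = [a, b]"
      by (cases p; cases "tl p"; cases "tl (tl p)") auto
    then show False
      using p uv by cases (auto simp: graph_path_def neighborhood_def insert_commute)
  qed
  then show "2 \<le> graph_dist V E u v"
    unfolding graph_dist_def by (intro INF_greatest) (auto simp: numeral_eq_enat)
qed

lemma far_if_graph_dist_ge_3:
  assumes G: "simple_graph V E" and xy: "x \<in> V" "y \<in> V" and d: "3 \<le> graph_dist V E x y"
  shows "neighborhood E x \<inter> neighborhood E y = {}" "y \<notin> neighborhood E x" "x \<noteq> y"
proof -
  have long: "3 \<le> length p - 1" if "graph_path V E x y p" for p
    using order_trans[OF d graph_dist_le[OF that]] by (simp add: numeral_eq_enat)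
  show ne: "x \<noteq> y" using long[of "[x]"] xy by (auto simp: graph_path_def)
  then show nadj: "y \<notin> neighborhood E x"
    using long[of "[x, y]"] xy by (auto simp: graph_path_def neighborhood_def)
  have "w \<notin> neighborhood E y" if "w \<in> neighborhood E x" for w
  proof
    assume w: "w \<in> neighborhood E y"
    then have "x \<noteq> w" "w \<noteq> y" using that not_mem_neighborhood_self[OF G] by blast+
    then show False
      using long[of "[x, w, y]"] xy ne that w neighborhood_in_V[OF G that]
      by (auto simp: graph_path_def neighborhood_def insert_commute)
  qed
  then show "neighborhood E x \<inter> neighborhood E y = {}" by blast
qed

lemma local_ore_graph_neighborhood:
  assumes G: "simple_graph V E" and lf: "locally_finite V E" and L1: "L1_graph V E"
    and two: "\<And>u v. u \<in> V \<Longrightarrow> v \<in> V \<Longrightarrow> graph_dist V E u v = 2 \<Longrightarrow>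
           card (neighborhood E u \<inter> neighborhood E v) \<ge> 2"
  shows "local_ore_graph (neighborhood E)"
proof
  let ?N = "neighborhood E"
  \<comment> \<open>Neighbourhoods outside \<open>V\<close> are empty, so finiteness holds on the
    whole type.\<close>
  show fin: "finite (?N u)" for u
  proof (cases "u \<in> V")
    case False
    then have "?N u = {}" using neighborhood_in_V[OF G] by blast
    then show ?thesis by simp
  qed (use lf in \<open>simp add: locally_finite_def\<close>)
  fix u v w assume uvw: "u \<noteq> v" "u \<notin> ?N v" "w \<in> ?N u" "w \<in> ?N v"
  have V: "u \<in> V" "v \<in> V" "w \<in> V" using uvw neighborhood_in_V[OF G] by blast+
  have d: "graph_dist V E u v = 2" using graph_dist_eq_2[OF G uvw] .
  show "2 \<le> card (?N u \<inter> ?N v)" using two[OF V(1,2) d] .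
  have "int (card (?N u \<union> ?N v \<union> ?N w)) - 1 \<le> int (card (?N u)) + int (card (?N v))"
    using L1 V d uvw unfolding L1_graph_def degree_def by blast
  moreover have "card (?N u \<union> ?N v \<union> ?N w) = card (?N u \<union> ?N v) + card (?N w - (?N u \<union> ?N v))"
    using fin by (subst card_Un_disjoint[symmetric]) (auto intro: arg_cong[of _ _ card])
  moreover have "card (?N u) + card (?N v) = card (?N u \<union> ?N v) + card (?N u \<inter> ?N v)"
    using fin by (intro card_Un_Int)
  ultimately show "card (?N w - (?N u \<union> ?N v)) \<le> card (?N u \<inter> ?N v) + 1" by linarith
next
  show "u \<in> neighborhood E v \<Longrightarrow> v \<in> neighborhood E u" for u v
    by (simp add: mem_neighborhood_sym)
qed (rule not_mem_neighborhood_self[OF G])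

theorem theorem6:
  fixes V :: "'a set" and E :: "'a set set" and x y :: 'a
  assumes "simple_graph V E"
    and "connected_graph V E"
    and "locally_finite V E"
    and "L1_graph V E"
    and "infinite V \<or> card V \<ge> 3"
    and "\<And>u v. u \<in> V \<Longrightarrow> v \<in> V \<Longrightarrow> graph_dist V E u v = 2 \<Longrightarrow>
           card (neighborhood E u \<inter> neighborhood E v) \<ge> 2"
    and "x \<in> V" and "y \<in> V" and "graph_dist V E x y \<ge> 3"
  shows "\<forall>n p. graph_path V E x y p \<and> length p = n \<and> set p \<noteq> V \<longrightarrow>
           (\<exists>l q. 1 \<le> l \<and> l \<le> 2 \<and> graph_path V E x y q \<and> length q = n + l \<and> set p \<subset> set q)"
proof (intro allI impI, elim conjE)
  fix n p assume p: "graph_path V E x y p" "length p = n" "set p \<noteq> V"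
  interpret local_ore_graph "neighborhood E"
    using local_ore_graph_neighborhood assms by blast
  have gp: "graph_path V E x y q \<longleftrightarrow> xypath x y q \<and> set q \<subseteq> V" for q
    by (auto simp: graph_path_def xypath_def neighborhood_def)
  note far = far_if_graph_dist_ge_3[OF assms(1,7,8,9)]
  obtain a where a: "a \<in> V" "a \<notin> set p" using p by (auto simp: graph_path_def)
  \<comment> \<open>A path to a missed vertex leaves \<open>set p\<close> along an edge, whose outer
    end serves as \<open>v\<close>.\<close>
  obtain r where r: "graph_path V E x a r" using assms(2,7) a by (auto simp: connected_graph_def)
  have "x \<in> set p" using p(1) by (auto simp: graph_path_def)
  with r a have "successively (\<lambda>u v. {u, v} \<in> E) r" "r \<noteq> []" "hd r \<in> set p" "last r \<notin> set p"
    by (auto simp: graph_path_def)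
  then obtain u v where uv: "u \<in> set p" "v \<notin> set p" "{u, v} \<in> E"
    using exit_edge[of "\<lambda>u v. {u, v} \<in> E" r "set p"] by blast
  have "extendable x y p v"
    using uv p gp far by (intro extendable_if_touching[of x y p v u]) (auto simp: neighborhood_def insert_commute)
  then obtain q where q: "xypath x y q" "length q \<in> {length p + 1, length p + 2}"
      "insert v (set p) \<subseteq> set q"
    by (auto simp: extendable_def)
  \<comment> \<open>\<open>xypath\<close> does not mention \<open>V\<close>: every vertex but the
    last starts an edge, and the last is \<open>y\<close>.\<close>
  have "set q \<subseteq> V"
  proof
    fix c assume "c \<in> set q"
    then obtain i where i: "i < length q" "c = q ! i" by (auto simp: in_set_conv_nth)
    show "c \<in> V"
    proof (cases "Suc i < length q")
      case True
      then show ?thesis using xypath_adj[OF q(1)] neighborhood_in_V[OF assms(1)] i by blast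
    next
      case False
      then have "i = length q - 1" using i by simp
      then show ?thesis using xypath_last[OF q(1)] i assms(8) by simp
    qed
  qed
  then have "graph_path V E x y q" using q gp by blast
  moreover have "set p \<subset> set q" using q(3) uv(2) by blast
  ultimately show "\<exists>l q. 1 \<le> l \<and> l \<le> 2 \<and> graph_path V E x y q \<and> length q = n + l \<and> set p \<subset> set q"
    using q(2) p(2) by (intro exI[of _ "length q - n"] exI[of _ q]) auto
qed

end
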